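(* Let $n$ be a nonnegative integer and let $\mathcal{F} \subseteq 2^{[n]}$ be a union-closed family with $\mathcal{F} \neq \{\emptyset\}$ and $|\mathcal{F}| \geq 2^{n-1}$. Then there is some element $i \in [n]$ such that $|\mathcal{F}_i| \geq \frac{1}{2}|\mathcal{F}|$.
   Context: Here $[n] = \{1,\dots,n\}$ and $2^{[n]}$ is the family of all subsets of $[n]$. A family $\mathcal{F} \subseteq 2^{[n]}$ is called union-closed if for every two sets $A, B \in \mathcal{F}$ we have $A \cup B \in \mathcal{F}$. For $i \in [n]$, $\mathcal{F}_i := \{A \in \mathcal{F} : i \in A\}$. *)

theory Defs
  imports Complex_Main
begin

definition union_closed :: "'a set set \<Rightarrow> bool" where
  "union_closed F \<longleftrightarrow> (\<forall>A\<in>F. \<forall>B\<in>F. A \<union> B \<in> F)"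

definition members_containing :: "'a set set \<Rightarrow> 'a \<Rightarrow> 'a set set" where
  "members_containing F i = {A \<in> F. i \<in> A}"

end

(* Let f be the indicator of F, and c i the mean of f (A - {i}) - f (insert i A) over all A, which is
   positive iff i lies in less than half of the members. On the Fourier side, the total influence is
   at least 8 Var f - (SUM i. (c i)^2). On the combinatorial side, a set outside the union-closed
   family F has at most one lower neighbour in F, so the upward boundary edges contribute at most
   2 g, where g <= 1/2 is the density of the complement of F. If every c i were positive, most
   boundary edges would be upward, and since c i <= 2 g the two estimates could only meet for
   g = 1/2 and all c i = 1, which forces n = 1 and F = {{}}. *)

theory Submission
  imports Defs
begin

definition avg :: "'a set \<Rightarrow> ('a set \<Rightarrow> real) \<Rightarrow> real" where
  "avg S f = (\<Sum>A\<in>Pow S. f A) / 2 ^ card S"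

text \<open>Both ends of an edge in direction \<open>i\<close> get the same value, so an average
  over the cube counts each edge twice.\<close>

definition ddiff :: "'a \<Rightarrow> ('a set \<Rightarrow> real) \<Rightarrow> 'a set \<Rightarrow> real" where
  "ddiff i f A = f (A - {i}) - f (insert i A)"

text \<open>Meant for \<open>A\<close> without \<open>x\<close>: there \<open>f A\<close> is the sum
  and \<open>f (insert x A)\<close> the difference of the even and odd parts, which carry the
  Fourier coefficients at sets avoiding and containing \<open>x\<close>.\<close>

definition even_part :: "'a \<Rightarrow> ('a set \<Rightarrow> real) \<Rightarrow> 'a set \<Rightarrow> real" where
  "even_part x f A = (f A + f (insert x A)) / 2"

definition odd_part :: "'a \<Rightarrow> ('a set \<Rightarrow> real) \<Rightarrow> 'a set \<Rightarrow> real" where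
  "odd_part x f A = (f A - f (insert x A)) / 2"

section \<open>Averages over the subsets of a finite set\<close>

lemma avg_cong: "(\<And>A. A \<subseteq> S \<Longrightarrow> f A = g A) \<Longrightarrow> avg S f = avg S g"
  unfolding avg_def by (auto intro!: sum.cong)

lemma avg_mono: "(\<And>A. A \<subseteq> S \<Longrightarrow> f A \<le> g A) \<Longrightarrow> avg S f \<le> avg S g"
  unfolding avg_def by (auto intro!: divide_right_mono sum_mono)

lemma avg_add: "avg S (\<lambda>A. f A + g A) = avg S f + avg S g"
  unfolding avg_def by (simp add: sum.distrib add_divide_distrib)

lemma avg_diff: "avg S (\<lambda>A. f A - g A) = avg S f - avg S g"
  unfolding avg_def by (simp add: sum_subtractf diff_divide_distrib)

lemma avg_cmult: "avg S (\<lambda>A. c * f A) = c * avg S f"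
  unfolding avg_def by (simp add: sum_distrib_left)

lemma avg_sum: "avg S (\<lambda>A. \<Sum>i\<in>I. f i A) = (\<Sum>i\<in>I. avg S (f i))"
  unfolding avg_def by (simp add: sum.swap[of _ I] sum_divide_distrib)

lemma avg_const: "finite S \<Longrightarrow> avg S (\<lambda>A. c) = c"
  unfolding avg_def by (simp add: card_Pow)

lemma avg_nonneg: "(\<And>A. A \<subseteq> S \<Longrightarrow> 0 \<le> f A) \<Longrightarrow> 0 \<le> avg S f"
  unfolding avg_def by (auto intro!: divide_nonneg_nonneg sum_nonneg)

lemma avg_of_bool:
  assumes "finite S"
  shows "avg S (\<lambda>A. of_bool (P A)) = card {A \<in> Pow S. P A} / 2 ^ card S"
  using assms by (simp add: avg_def of_bool_def sum.If_cases Int_def)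

lemma avg_insert:
  assumes "finite S" "x \<notin> S"
  shows "avg (insert x S) f = avg S (even_part x f)"
proof -
  have "Pow S \<inter> insert x ` Pow S = {}"
    using assms by auto
  moreover have "inj_on (insert x) (Pow S)"
    using assms by (auto intro!: inj_onI dest: insert_ident[THEN iffD1, rotated 2])
  ultimately have "sum f (Pow (insert x S)) = (\<Sum>A\<in>Pow S. f A + f (insert x A))"
    using assms by (simp add: Pow_insert sum.union_disjoint sum.reindex sum.distrib)
  then show ?thesis
    using assms by (simp add: avg_def even_part_def[abs_def] sum_divide_distrib[symmetric])
qed

text \<open>Folds each edge in direction \<open>i\<close> onto its upper end.\<close>

lemma avg_split:
  assumes "finite S" "i \<in> S"
  shows "avg S f = avg S (\<lambda>A. of_bool (i \<in> A) * (f A + f (A - {i})))"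
proof -
  have S: "S = insert i (S - {i})"
    using assms by auto
  have "avg (insert i (S - {i})) f
      = avg (insert i (S - {i})) (\<lambda>A. of_bool (i \<in> A) * (f A + f (A - {i})))"
    using assms by (subst (1 2) avg_insert)
      (auto intro!: avg_cong simp: even_part_def insert_Diff_if add.commute subset_Diff_insert)
  then show ?thesis
    using S by simp
qed

lemma avg_sq_insert:
  assumes "finite S" "x \<notin> S"
  shows "avg (insert x S) (\<lambda>A. (f A)\<^sup>2)
    = avg S (\<lambda>A. (even_part x f A)\<^sup>2) + avg S (\<lambda>A. (odd_part x f A)\<^sup>2)"
  using assms unfolding avg_add[symmetric]
  by (auto simp: avg_insert even_part_def odd_part_def power2_eq_square field_simps intro!: avg_cong)

lemma ddiff_insert_new:
  assumes "finite S" "x \<notin> S"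
  shows "avg (insert x S) (ddiff x f) = 2 * avg S (odd_part x f)"
    and "avg (insert x S) (\<lambda>A. (ddiff x f A)\<^sup>2) = 4 * avg S (\<lambda>A. (odd_part x f A)\<^sup>2)"
proof -
  have *: "A - {x} = A" if "A \<subseteq> S" for A
    using assms that by auto
  show "avg (insert x S) (ddiff x f) = 2 * avg S (odd_part x f)"
    using assms unfolding avg_cmult[symmetric]
    by (auto simp: avg_insert even_part_def ddiff_def odd_part_def * intro!: avg_cong)
  show "avg (insert x S) (\<lambda>A. (ddiff x f A)\<^sup>2) = 4 * avg S (\<lambda>A. (odd_part x f A)\<^sup>2)"
    using assms unfolding avg_cmult[symmetric]
    by (auto simp: avg_insert even_part_def ddiff_def odd_part_def * power_divide intro!: avg_cong)
qed

text \<open>Differences in direction \<open>i\<close> commute with the splitting along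
  \<open>x\<close>; the odd part cancels in the mean and the cross terms cancel in the
  squares.\<close>

lemma ddiff_insert_old:
  assumes "finite S" "x \<notin> S" "i \<in> S"
  shows "avg (insert x S) (ddiff i f) = avg S (ddiff i (even_part x f))"
    and "avg (insert x S) (\<lambda>A. (ddiff i f A)\<^sup>2)
      = avg S (\<lambda>A. (ddiff i (even_part x f) A)\<^sup>2) + avg S (\<lambda>A. (ddiff i (odd_part x f) A)\<^sup>2)"
proof -
  have *: "insert x A - {i} = insert x (A - {i})" "insert i (insert x A) = insert x (insert i A)" for A
    using assms by auto
  show "avg (insert x S) (ddiff i f) = avg S (ddiff i (even_part x f))"
    using assms by (auto simp: avg_insert even_part_def ddiff_def * field_simps intro!: avg_cong)
  show "avg (insert x S) (\<lambda>A. (ddiff i f A)\<^sup>2)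
      = avg S (\<lambda>A. (ddiff i (even_part x f) A)\<^sup>2) + avg S (\<lambda>A. (ddiff i (odd_part x f) A)\<^sup>2)"
    using assms unfolding avg_add[symmetric]
    by (auto simp: avg_insert even_part_def ddiff_def odd_part_def * power2_eq_square field_simps intro!: avg_cong)
qed

section \<open>Lower bounds on the total influence\<close>

lemma total_influence_insert:
  assumes "finite S" "x \<notin> S"
  shows "(\<Sum>i\<in>insert x S. avg (insert x S) (\<lambda>A. (ddiff i f A)\<^sup>2))
    = (\<Sum>i\<in>S. avg S (\<lambda>A. (ddiff i (even_part x f) A)\<^sup>2))
      + (\<Sum>i\<in>S. avg S (\<lambda>A. (ddiff i (odd_part x f) A)\<^sup>2))
      + 4 * avg S (\<lambda>A. (odd_part x f A)\<^sup>2)"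
  using assms by (simp add: ddiff_insert_new(2) ddiff_insert_old(2) sum.distrib)

lemma first_level_insert:
  assumes "finite S" "x \<notin> S"
  shows "(\<Sum>i\<in>insert x S. (avg (insert x S) (ddiff i f))\<^sup>2)
    = (\<Sum>i\<in>S. (avg S (ddiff i (even_part x f)))\<^sup>2) + 4 * (avg S (odd_part x f))\<^sup>2"
  using assms by (simp add: ddiff_insert_new(1) ddiff_insert_old(1) power_mult_distrib)

text \<open>Direction \<open>x\<close> contributes exactly 4 times the mean square of the odd part,
  which is what the variance gains; the influences of the odd part are discarded.\<close>

lemma poincare:
  assumes "finite S"
  shows "4 * (avg S (\<lambda>A. (f A)\<^sup>2) - (avg S f)\<^sup>2) \<le> (\<Sum>i\<in>S. avg S (\<lambda>A. (ddiff i f A)\<^sup>2))"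
  using assms
proof (induction S arbitrary: f rule: finite_induct)
  case empty
  then show ?case
    by (simp add: avg_def)
next
  case (insert x S)
  have "0 \<le> (\<Sum>i\<in>S. avg S (\<lambda>A. (ddiff i (odd_part x f) A)\<^sup>2))"
    by (intro sum_nonneg avg_nonneg) simp
  then show ?case
    using insert.IH[of "even_part x f"] insert.hyps
      total_influence_insert[OF insert.hyps, of f] avg_sq_insert[OF insert.hyps, of f]
      avg_insert[OF insert.hyps, of f] by simp
qed

text \<open>In Fourier terms, the levels at least two contribute at least twice their weight to the
  total influence, and the coefficients of level one are the averages of the differences.\<close>

lemma poincare_level_two:
  assumes "finite S"
  shows "8 * (avg S (\<lambda>A. (f A)\<^sup>2) - (avg S f)\<^sup>2)
    \<le> (\<Sum>i\<in>S. avg S (\<lambda>A. (ddiff i f A)\<^sup>2)) + (\<Sum>i\<in>S. (avg S (ddiff i f))\<^sup>2)"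
  using assms
proof (induction S arbitrary: f rule: finite_induct)
  case empty
  then show ?case
    by (simp add: avg_def)
next
  case (insert x S)
  show ?case
    \<comment> \<open>The odd part must supply 8 times its mean square: direction \<open>x\<close>
      gives 4, \<open>poincare\<close> gives 4 times its variance, and the new first-level term
      restores the squared mean.\<close>
    using insert.IH[of "even_part x f"] insert.hyps poincare[OF insert.hyps(1), of "odd_part x f"]
      total_influence_insert[OF insert.hyps, of f] first_level_insert[OF insert.hyps, of f]
      avg_sq_insert[OF insert.hyps, of f] avg_insert[OF insert.hyps, of f] by simp
qed

text \<open>If deleting either of two distinct elements from a non-member gave a member, their union
  would be a member; so a non-member has at most one lower neighbour in \<open>F\<close>.\<close>

lemma union_closed_lower_neighbour:
  assumes "union_closed F" "B \<notin> F" "finite S"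
  shows "(\<Sum>i\<in>S. of_bool (i \<in> B \<and> B - {i} \<in> F)) \<le> (1::real)"
proof -
  have "i = j" if "i \<in> B" "B - {i} \<in> F" "j \<in> B" "B - {j} \<in> F" for i j
  proof (rule ccontr)
    assume "i \<noteq> j"
    then have "(B - {i}) \<union> (B - {j}) = B" by auto
    then show False
      using assms that unfolding union_closed_def by metis
  qed
  then have "card {i \<in> S. i \<in> B \<and> B - {i} \<in> F} \<le> 1"
    using assms by (auto simp: card_le_Suc0_iff_eq)
  then show ?thesis
    using assms by (simp add: of_bool_def sum.If_cases Int_def)
qed

section \<open>From the two estimates to a frequent element\<close>

lemma union_closed_frequent_element:
  assumes "finite S" "F \<subseteq> Pow S" "union_closed F" "F \<noteq> {{}}"
    and large: "2 * card F \<ge> 2 ^ card S"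
  shows "\<exists>i\<in>S. card F \<le> 2 * card (members_containing F i)"
proof (rule ccontr)
  assume contra: "\<not> ?thesis"
  define f :: "'a set \<Rightarrow> real" where "f A = of_bool (A \<in> F)" for A
  define g where "g = 1 - avg S f"
  define c where "c i = avg S (ddiff i f)" for i
  \<comment> \<open>\<open>p\<close> and \<open>q\<close> measure the boundary edges along which
    going up leaves or enters \<open>F\<close>.\<close>
  define p where "p i = avg S (\<lambda>A. of_bool (A - {i} \<in> F \<and> insert i A \<notin> F))" for i
  define q where "q i = avg S (\<lambda>A. of_bool (A - {i} \<notin> F \<and> insert i A \<in> F))" for i
  have avg_f: "avg S f = card F / 2 ^ card S"
    using assms unfolding f_def by (subst avg_of_bool) (auto intro!: arg_cong[where f=card])
  have "real (2 ^ card S) \<le> real (2 * card F)"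
    using large by (simp only: of_nat_le_iff)
  then have g_half: "g \<le> 1/2"
    by (simp add: g_def avg_f field_simps)
  have c_pos: "0 < c i" if "i \<in> S" for i
  proof -
    have "card (members_containing F i) * 2 < card F"
      using contra that by force
    then have "real (card (members_containing F i) * 2) < real (card F)"
      by (simp only: of_nat_less_iff)
    moreover have "avg S (\<lambda>A. of_bool (i \<in> A) * f A) = card (members_containing F i) / 2 ^ card S"
      using assms unfolding f_def of_bool_conj[symmetric] members_containing_def
      by (subst avg_of_bool) (auto intro!: arg_cong[where f=card])
    moreover have "c i = 2 * avg S f - 4 * avg S (\<lambda>A. of_bool (i \<in> A) * f A)"
      using assms(1) that unfolding c_def
      by (subst (1 2) avg_split[of S i], simp, simp)
        (auto simp: ddiff_def insert_absorb avg_cmult[symmetric] avg_diff[symmetric] intro!: avg_cong)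
    ultimately have "c i = (2 * card F - 4 * card (members_containing F i)) / 2 ^ card S"
      and "2 * real (card (members_containing F i)) < card F"
      by (simp_all add: avg_f diff_divide_distrib)
    then show ?thesis
      by simp
  qed
  have c_pq: "c i = p i - q i" for i
    unfolding c_def p_def q_def avg_diff[symmetric]
    by (rule avg_cong) (auto simp: ddiff_def f_def)
  have D_pq: "avg S (\<lambda>A. (ddiff i f A)\<^sup>2) = p i + q i" for i
    unfolding p_def q_def avg_add[symmetric]
    by (rule avg_cong) (auto simp: ddiff_def f_def)
  have q_nonneg: "0 \<le> q i" for i
    unfolding q_def by (rule avg_nonneg) simp
  \<comment> \<open>Charge each such edge to its upper end, a non-member; the 2 counts both
    ends.\<close>
  have p_split: "p i = 2 * avg S (\<lambda>B. of_bool (i \<in> B \<and> B - {i} \<in> F) * of_bool (B \<notin> F))"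
    if "i \<in> S" for i
    using assms(1) that unfolding p_def avg_cmult[symmetric]
    by (subst avg_split[of S i], simp, simp) (auto simp: insert_absorb intro!: avg_cong)
  have avg_compl: "avg S (\<lambda>B. of_bool (B \<notin> F)) = g"
    using avg_diff[of S "\<lambda>_. 1" f] assms(1) by (simp add: g_def f_def avg_const of_bool_not_iff)
  have p_le: "p i \<le> 2 * g" if "i \<in> S" for i
    unfolding p_split[OF that] avg_compl[symmetric] by (auto intro!: avg_mono)
  have sum_p: "sum p S \<le> 2 * g"
  proof -
    have "sum p S = 2 * avg S (\<lambda>B. (\<Sum>i\<in>S. of_bool (i \<in> B \<and> B - {i} \<in> F)) * of_bool (B \<notin> F))"
      by (simp add: p_split avg_sum sum_distrib_left sum_distrib_right)
    also have "\<dots> \<le> 2 * avg S (\<lambda>B. of_bool (B \<notin> F))"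
      using union_closed_lower_neighbour[OF assms(3) _ assms(1)] by (auto intro!: avg_mono)
    finally show ?thesis by (simp add: avg_compl)
  qed
  have c_le: "c i \<le> 2 * g" if "i \<in> S" for i
    using c_pq[of i] q_nonneg[of i] p_le[OF that] by simp
  have "F \<noteq> {}"
    using large by auto
  \<comment> \<open>Over the empty set the only nonempty family is \<open>{{}}\<close>.\<close>
  then have S_ne: "S \<noteq> {}"
    using assms by auto
  have g_pos: "0 < g"
    using S_ne c_pos c_le by fastforce
  have sum_c: "sum c S = sum p S - sum q S"
    by (simp add: c_pq sum_subtractf)
  have sum_c_pos: "0 < sum c S"
    using c_pos S_ne assms(1) by (simp add: sum_pos)
  have W: "(\<Sum>i\<in>S. (c i)\<^sup>2) \<le> 2 * g * sum c S"
    unfolding sum_distrib_left power2_eq_square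
    using c_le c_pos by (intro sum_mono mult_right_mono) (auto simp: less_imp_le)
  have "avg S (\<lambda>A. (f A)\<^sup>2) = avg S f"
    by (rule avg_cong) (simp add: f_def)
  then have "avg S (\<lambda>A. (f A)\<^sup>2) - (avg S f)\<^sup>2 = g * (1 - g)"
    by (simp add: g_def power2_eq_square algebra_simps)
  then have key: "8 * (g * (1 - g)) \<le> sum p S + sum q S + (\<Sum>i\<in>S. (c i)\<^sup>2)"
    using poincare_level_two[OF assms(1), of f] by (simp add: D_pq sum.distrib c_def)
  have lower: "4 * g \<le> 8 * (g * (1 - g))"
    using mult_left_mono[OF g_half, of g] g_pos by (simp add: algebra_simps)
  \<comment> \<open>Since \<open>q\<close> is \<open>p\<close> minus \<open>c\<close>, the influence
    is \<open>2 * sum p S - sum c S\<close>, at most \<open>4 * g - sum c S\<close>.\<close>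
  have upper: "sum p S + sum q S + 2 * g * sum c S \<le> 4 * g - (1 - 2 * g) * sum c S"
    using sum_c sum_p by (simp add: algebra_simps)
  have g_eq: "g = 1/2"
  proof (rule ccontr)
    assume "g \<noteq> 1/2"
    then have "0 < (1 - 2 * g) * sum c S"
      using g_half sum_c_pos by (intro mult_pos_pos) auto
    then show False
      using key W lower upper by linarith
  qed
  \<comment> \<open>At \<open>g = 1/2\<close> the influence is at most \<open>2 - sum c S\<close>,
    while \<open>key\<close> makes it at least 2 minus the sum of squares. As every
    \<open>c i\<close> lies in (0, 1], each summand must vanish.\<close>
  have tight: "(\<Sum>i\<in>S. c i - (c i)\<^sup>2) \<le> 0"
    using key upper unfolding g_eq by (simp add: sum_subtractf)
  have c_1: "c i = 1" if "i \<in> S" for i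
  proof -
    have nonneg: "0 \<le> c j - (c j)\<^sup>2" if "j \<in> S" for j
      using c_le[OF that] c_pos[OF that] g_eq
      by (simp add: power2_eq_square mult_left_le)
    then have "(\<Sum>i\<in>S. c i - (c i)\<^sup>2) = 0"
      using tight by (intro antisym sum_nonneg) auto
    then have "c i - (c i)\<^sup>2 = 0"
      using nonneg that assms(1) by (subst (asm) sum_nonneg_eq_0_iff) auto
    then show ?thesis
      using c_pos[OF that] by (simp add: power2_eq_square)
  qed
  \<comment> \<open>\<open>card S\<close> equals \<open>sum c S\<close>, hence is at most
    \<open>sum p S \<le> 2 * g = 1\<close>.\<close>
  have "real (card S) \<le> 1"
    using c_1 sum_c sum_p g_eq sum_nonneg[of S q] q_nonneg by simp
  then have "card S = 1"
    using S_ne assms(1) by (simp add: le_Suc_eq)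
  then obtain s where S: "S = {s}"
    by (auto simp: card_1_singleton_iff)
  then have "{s} \<in> F"
    using assms \<open>F \<noteq> {}\<close> by (auto simp: subset_singleton_iff Pow_insert)
  then have "members_containing F s = {{s}}" "card F \<le> 2"
    using assms(2) S card_mono[of "{{}, {s}}" F]
    by (auto simp: members_containing_def Pow_insert numeral_2_eq_2)
  then show False
    using contra S by simp
qed

theorem theorem1p2:
  fixes n :: nat and F :: "nat set set"
  assumes "F \<subseteq> Pow {1..n}"
    and "union_closed F"
    and "F \<noteq> {{}}"
    and "real (card F) \<ge> 2 powi (int n - 1)"
  shows "\<exists>i\<in>{1..n}. real (card (members_containing F i)) \<ge> 1 / 2 * real (card F)"
proof -
  \<comment> \<open>Doubling clears the exponent, which is -1 for \<open>n = 0\<close>.\<close>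
  have "(2::real) ^ n \<le> 2 * real (card F)"
    using assms(4) by (simp add: power_int_diff field_simps)
  then have "real (2 ^ n) \<le> real (2 * card F)"
    by simp
  then have large: "2 ^ card {1..n} \<le> 2 * card F"
    by (simp only: of_nat_le_iff card_atLeastAtMost diff_Suc_1)
  then obtain i where "i \<in> {1..n}" "card F \<le> 2 * card (members_containing F i)"
    using union_closed_frequent_element[OF _ assms(1-3) large] by blast
  then show ?thesis
    by (intro bexI[of _ i]) simp_all
qed

end
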